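(* Let $D,Q\in\mathbb N$ with $(D,Q)=1$ and $D/Q>1$, and suppose $D/Q$ is not the square of a rational number. Let $q$ be the smallest (positive) divisor of $Q$ such that $Q\mid q^2$, and put $D_1=Dq^2/Q\in\mathbb N$ and $D_2=DQ$. Let $m\ge 0$ be the smallest integer such that $\sqrt{D/Q}$ has the periodic continued fraction expansion $\sqrt{D/Q}=[b_0,\{b_1,\ldots,b_m,2b_0\}]$ with $b_0,\ldots,b_m\in\mathbb N$, and let $r_k/s_k$, $k=0,1,2,\ldots$, be the $k$th convergent of $\sqrt{D/Q}$. Then the units $>1$ of $\mathbb Z[\sqrt{D_2}]$ are exactly the numbers $r+s\sqrt{D_1}$ with $r,s\in\mathbb Z$ such that $r=r_k$ and $sq=s_k$, where $k=l(m+1)-1$, $l\in\mathbb N$; i.e., the corresponding fractions $r_k/s_k$ are the convergents of $\sqrt{D/Q}$ occurring just before the end of each period (in particular $q\mid s_k$ for each such $k$).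
   Context: $\mathbb N=\{1,2,3,\ldots\}$ and $(a,b)$ denotes the greatest common divisor. The notation $[b_0,\{b_1,\ldots,b_m,2b_0\}]$ denotes the infinite simple continued fraction with initial term $b_0$ followed by the block $b_1,\ldots,b_m,2b_0$ (of length $m+1$) repeated periodically forever; for $D/Q>1$ as in the claim, $\sqrt{D/Q}$ always has an expansion of this form. Convergents $r_k/s_k=[b_0,b_1,\ldots,b_k]$ are indexed from $k=0$ and written in lowest terms with $r_k,s_k\in\mathbb N$, $(r_k,s_k)=1$. Since $D_2=D_1(Q/q)^2$, the ring $\mathbb Z[\sqrt{D_2}]$ is contained in $\mathbb Z[\sqrt{D_1}]$. *)

theory Defs
  imports Complex_Main
begin

text \<open>
  The finite simple continued fraction \<open>[b 0, b 1, \<dots>, b k]\<close>.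
\<close>
fun cfrac_conv :: "(nat \<Rightarrow> nat) \<Rightarrow> nat \<Rightarrow> real" where
  "cfrac_conv b 0 = real (b 0)"
| "cfrac_conv b (Suc k) = real (b 0) + 1 / cfrac_conv (\<lambda>i. b (Suc i)) k"

text \<open>
  \<open>x = [b 0, b 1, b 2, \<dots>]\<close>, where all the terms, including \<open>b 0\<close>, are positive
  (so only numbers \<open>x > 1\<close> have such an expansion).
\<close>
definition has_cfrac :: "(nat \<Rightarrow> nat) \<Rightarrow> real \<Rightarrow> bool" where
  "has_cfrac b x \<longleftrightarrow> (\<forall>i. b i > 0) \<and> cfrac_conv b \<longlonglongrightarrow> x"

text \<open>
  \<open>x = [b 0, {b 1, \<dots>, b m, 2 * b 0}]\<close>: the block in braces, which has length \<open>m + 1\<close>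
  and occupies the positions \<open>1, \<dots>, m + 1\<close>, is repeated forever. The number \<open>m + 1\<close> need
  not be the minimal period length.
\<close>
definition has_periodic_cfrac :: "nat \<Rightarrow> (nat \<Rightarrow> nat) \<Rightarrow> real \<Rightarrow> bool" where
  "has_periodic_cfrac m b x \<longleftrightarrow>
     has_cfrac b x \<and> b (m + 1) = 2 * b 0 \<and> (\<forall>i\<ge>1. b (i + (m + 1)) = b i)"

text \<open>The ring \<open>\<int>[\<surd>n]\<close> as a subset of the reals.\<close>
definition Z_sqrt :: "nat \<Rightarrow> real set" where
  "Z_sqrt n = {of_int x + of_int y * sqrt (real n) | x y :: int. True}"

definition units_in :: "'a::comm_ring_1 set \<Rightarrow> 'a set" where
  "units_in R = {u \<in> R. \<exists>v\<in>R. u * v = 1}"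

end

theory Submission
  imports Defs
begin

text \<open>
  Put \<open>x = \<surd>(D/Q)\<close> and let \<open>X\<^sub>n\<close> be its complete quotients. Everything rests on the identity
  \<open>(s\<^sub>n x - r\<^sub>n) X\<^sub>n\<^sub>+\<^sub>1 = - (s\<^sub>n\<^sub>-\<^sub>1 x - r\<^sub>n\<^sub>-\<^sub>1)\<close>. If a period ends after index \<open>k\<close>, then
  \<open>X\<^sub>k\<^sub>+\<^sub>1 = x + b\<^sub>0\<close>; comparing rational and irrational parts gives \<open>Q dvd s\<^sub>k\<close> and
  \<open>r\<^sub>k\<^sup>2 - x\<^sup>2 s\<^sub>k\<^sup>2 = \<plusminus>1\<close>, a unit of \<open>\<int>[\<surd>(D Q)]\<close>. Conversely, a unit \<open>p + y \<surd>(D Q) > 1\<close> yields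
  a fraction \<open>p / (y Q)\<close> so close to \<open>x\<close> that it is a convergent by Legendre's criterion, and
  the norm equation then forces \<open>X\<^sub>k\<^sub>+\<^sub>1 - x\<close> to be an integer. Hence \<open>k + 1\<close> is a
  period, and so a multiple of the minimal one.
\<close>

section \<open>Numerators and denominators of convergents\<close>

text \<open>The index is shifted by one, so that \<open>cfrac_num b (k + 1) / cfrac_den b (k + 1)\<close> is the
  \<open>k\<close>th convergent.\<close>

fun cfrac_num :: "(nat \<Rightarrow> nat) \<Rightarrow> nat \<Rightarrow> int" where
  "cfrac_num b 0 = 1"
| "cfrac_num b (Suc 0) = int (b 0)"
| "cfrac_num b (Suc (Suc n)) = int (b (Suc n)) * cfrac_num b (Suc n) + cfrac_num b n"

fun cfrac_den :: "(nat \<Rightarrow> nat) \<Rightarrow> nat \<Rightarrow> int" where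
  "cfrac_den b 0 = 0"
| "cfrac_den b (Suc 0) = 1"
| "cfrac_den b (Suc (Suc n)) = int (b (Suc n)) * cfrac_den b (Suc n) + cfrac_den b n"

text \<open>\<open>cfrac_conv\<close> unfolds at the front of the expansion, the recurrences of
  numerators and denominators at its end. This lemma and the next translate between the two, which
  the induction for \<open>cfrac_conv_eq\<close> needs.\<close>

lemma cfrac_den_Suc: "cfrac_den b (Suc n) = cfrac_num (\<lambda>i. b (Suc i)) n"
  by (induction "\<lambda>i. b (Suc i)" n rule: cfrac_num.induct) auto

lemma cfrac_num_Suc:
  "cfrac_num b (Suc n) =
     int (b 0) * cfrac_num (\<lambda>i. b (Suc i)) n + cfrac_den (\<lambda>i. b (Suc i)) n"
  by (induction "\<lambda>i. b (Suc i)" n rule: cfrac_num.induct) (auto simp: algebra_simps)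

lemma cfrac_det:
  "cfrac_num b (Suc n) * cfrac_den b n - cfrac_num b n * cfrac_den b (Suc n) = (-1) ^ Suc n"
  by (induction n) (auto simp: algebra_simps)

lemma coprime_cfrac_num_den: "coprime (cfrac_num b n) (cfrac_den b n)"
proof (rule coprimeI)
  fix c assume c: "c dvd cfrac_num b n" "c dvd cfrac_den b n"
  then have "c dvd cfrac_num b (Suc n) * cfrac_den b n - cfrac_num b n * cfrac_den b (Suc n)"
    by (simp add: dvd_diff)
  then have "c dvd (-1) ^ Suc n"
    by (simp only: cfrac_det)
  then show "is_unit c"
    using dvd_trans[of c "(-1) ^ Suc n" 1] by (simp add: is_unit_power_iff)
qed

lemma cfrac_num_pos: "(\<And>i. b i > 0) \<Longrightarrow> cfrac_num b n > 0"
  by (induction b n rule: cfrac_num.induct) (auto intro!: add_pos_pos)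

lemma cfrac_den_pos: "(\<And>i. b i > 0) \<Longrightarrow> cfrac_den b (Suc n) > 0"
  by (simp add: cfrac_den_Suc cfrac_num_pos)

text \<open>From the second step on, the recurrence adds a positive earlier denominator, so
  denominators grow by at least 1. This unboundedness lets \<open>legendre\<close> find a convergent
  with denominator beyond any given integer.\<close>

lemma cfrac_den_ge: "(\<And>i. b i > 0) \<Longrightarrow> cfrac_den b (Suc n) \<ge> int n"
proof (induction n)
  case (Suc n)
  show ?case
  proof (cases n)
    case 0
    then show ?thesis using cfrac_den_pos[of b 1] Suc.prems by fastforce
  next
    case (Suc j)
    have "cfrac_den b (Suc n) + 1 \<le> int (b (Suc n)) * cfrac_den b (Suc n) + cfrac_den b n"
      using Suc cfrac_den_pos[of b j] cfrac_den_pos[of b n] \<open>\<And>i. b i > 0\<close>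
      by (intro add_mono) (auto simp: mult_le_cancel_right1 Suc_leI)
    then show ?thesis using Suc.IH Suc.prems by simp
  qed
qed simp

lemma cfrac_conv_eq:
  "(\<And>i. b i > 0) \<Longrightarrow> cfrac_conv b n = cfrac_num b (Suc n) / cfrac_den b (Suc n)"
proof (induction n arbitrary: b)
  case (Suc n)
  let ?c = "\<lambda>i. b (Suc i)"
  have "cfrac_num ?c (Suc n) > 0" "cfrac_den ?c (Suc n) > 0"
    using Suc.prems by (auto intro!: cfrac_num_pos cfrac_den_pos)
  then show ?case
    unfolding cfrac_conv.simps Suc.IH[of ?c, OF Suc.prems]
      cfrac_num_Suc[of b "Suc n"] cfrac_den_Suc[of b "Suc n"]
    by (simp add: field_simps del: cfrac_num.simps cfrac_den.simps)
qed simp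

lemma cfrac_conv_ge: "(\<And>i. b i > 0) \<Longrightarrow> cfrac_conv b n \<ge> real (b 0)"
proof (induction n arbitrary: b)
  case (Suc n)
  then show ?case using order_trans[OF _ Suc.IH[of "\<lambda>i. b (Suc i)"], of 0] by simp
qed simp

lemma coprime_fraction_eq:
  fixes p q p' q' :: int
  assumes "p * q' = p' * q" "coprime p q" "coprime p' q'" "q > 0" "q' > 0"
  shows "p = p'" "q = q'"
proof -
  have "q dvd q'" "q' dvd q"
    using assms
    by (metis coprime_commute coprime_dvd_mult_right_iff dvd_triv_right)+
  then show "q = q'" using assms by (simp add: zdvd_antisym_nonneg)
  then show "p = p'" using assms by simp
qed

lemma irrational_combination_eq_0:
  fixes x :: real and a c :: int
  assumes "x \<notin> \<rat>" "of_int a * x = of_int c"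
  shows "a = 0" "c = 0"
proof -
  show "a = 0"
  proof (rule ccontr)
    assume "a \<noteq> 0"
    then have "x = of_int c / of_int a" using assms by (simp add: field_simps)
    then show False using assms(1) by simp
  qed
  then show "c = 0" using assms by simp
qed

section \<open>Complete quotients\<close>

locale irrational_cfrac =
  fixes b :: "nat \<Rightarrow> nat" and x :: real
  assumes expansion: "has_cfrac b x" and irrational: "x \<notin> \<rat>"
begin

lemma pos: "b i > 0"
  using expansion by (simp add: has_cfrac_def)

primrec quot :: "nat \<Rightarrow> real" where
  "quot 0 = x"
| "quot (Suc n) = 1 / (quot n - real (b n))"

end

text \<open>One step of the continued fraction algorithm, stated for arbitrary \<open>b\<close> and
  \<open>x\<close> so that \<open>cfrac_quot\<close> can iterate it on shifted sequences.
  Convergents lie between \<open>b 0\<close> and \<open>b 0 + 1\<close>; the limit inherits only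
  weak bounds, and irrationality makes them strict.\<close>

lemma cfrac_step:
  assumes "has_cfrac b x" "x \<notin> \<rat>"
  shows "has_cfrac (\<lambda>i. b (Suc i)) (1 / (x - real (b 0)))"
    and "1 / (x - real (b 0)) \<notin> \<rat>"
    and "real (b 0) < x" and "x < real (b 0) + 1"
proof -
  have pos: "\<And>i. b i > 0" and lim: "cfrac_conv b \<longlonglongrightarrow> x"
    using assms(1) by (auto simp: has_cfrac_def)
  have ne: "x \<noteq> real (b 0)" "x \<noteq> real (b 0) + 1"
    using assms(2) by auto
  have lim': "(\<lambda>n. cfrac_conv b (Suc n)) \<longlonglongrightarrow> x"
    using lim by (rule LIMSEQ_Suc)
  then have "(\<lambda>n. 1 / (cfrac_conv b (Suc n) - real (b 0))) \<longlonglongrightarrow> 1 / (x - real (b 0))"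
    using ne by (intro tendsto_intros) auto
  then show "has_cfrac (\<lambda>i. b (Suc i)) (1 / (x - real (b 0)))"
    using pos by (simp add: has_cfrac_def)
  show "1 / (x - real (b 0)) \<notin> \<rat>"
  proof
    assume "1 / (x - real (b 0)) \<in> \<rat>"
    then have "1 / (1 / (x - real (b 0))) + real (b 0) \<in> \<rat>"
      by (rule Rats_add[OF Rats_divide[OF Rats_1] Rats_of_nat])
    then show False using assms(2) by simp
  qed
  have "real (b 0) \<le> x"
    using cfrac_conv_ge[of b] pos by (intro LIMSEQ_le_const[OF lim]) auto
  then show "real (b 0) < x" using ne by simp
  have "cfrac_conv b (Suc n) \<le> real (b 0) + 1" for n
  proof -
    have "cfrac_conv (\<lambda>i. b (Suc i)) n \<ge> 1"
      using order_trans[OF _ cfrac_conv_ge[of "\<lambda>i. b (Suc i)" n], of 1] pos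
      by (simp add: Suc_leI)
    then show ?thesis by simp
  qed
  then have "x \<le> real (b 0) + 1"
    by (intro LIMSEQ_le_const2[OF lim']) auto
  then show "x < real (b 0) + 1" using ne by simp
qed

context irrational_cfrac
begin

lemma cfrac_quot: "has_cfrac (\<lambda>i. b (i + n)) (quot n) \<and> quot n \<notin> \<rat>"
proof (induction n)
  case 0
  show ?case using expansion irrational by simp
next
  case (Suc n)
  then show ?case using cfrac_step(1,2)[of "\<lambda>i. b (i + n)" "quot n"] by simp
qed

lemma quot_bounds: "real (b n) < quot n" "quot n < real (b n) + 1"
  using cfrac_step(3,4)[of "\<lambda>i. b (i + n)" "quot n"] cfrac_quot[of n] by auto

lemma quot_gt_1: "quot n > 1"
  using quot_bounds(1)[of n] pos[of n] by linarith

lemma quot_floor: "\<lfloor>quot n\<rfloor> = int (b n)"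
  using quot_bounds[of n] by (intro floor_unique) auto

lemma quot_eq: "quot n = real (b n) + 1 / quot (Suc n)"
  using quot_bounds(1)[of n] by simp

text \<open>The index is shifted as for \<open>cfrac_num\<close>: \<open>err (Suc n)\<close> is the
  signed error of the \<open>n\<close>th convergent times its denominator, and \<open>err 0\<close>
  belongs to the formal convergent 1/0.\<close>

definition err :: "nat \<Rightarrow> real" where
  "err n = of_int (cfrac_den b n) * x - of_int (cfrac_num b n)"

lemma err_0: "err 0 = -1"
  by (simp add: err_def)

lemma err_rec: "err (Suc (Suc n)) = real (b (Suc n)) * err (Suc n) + err n"
  by (simp add: err_def algebra_simps)

text \<open>Dividing \<open>err_rec\<close> by \<open>err (Suc n)\<close> gives the recursion
  \<open>quot_eq\<close>, so the negated ratios of consecutive errors are the complete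
  quotients.\<close>

lemma err_quot: "err (Suc n) * quot (Suc n) = - err n"
proof (induction n)
  case 0
  show ?case using quot_bounds(1)[of 0] by (simp add: err_def)
next
  case (Suc n)
  have "err (Suc (Suc n)) = err (Suc n) * (real (b (Suc n)) - quot (Suc n))"
    using Suc by (simp add: err_rec algebra_simps)
  also have "\<dots> = - err (Suc n) / quot (Suc (Suc n))"
    using quot_eq[of "Suc n"] by (simp del: quot.simps)
  finally show ?case
    using quot_gt_1[of "Suc (Suc n)"] by (simp del: quot.simps)
qed

text \<open>Complete quotients are positive, so by \<open>err_quot\<close> consecutive errors have
  opposite signs.\<close>

lemma err_sign: "(-1) ^ n * err n < 0"
proof (induction n)
  case (Suc n)
  have "(-1) ^ Suc n * err (Suc n) * quot (Suc n) = (-1) ^ n * err n"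
    using err_quot[of n] by (simp add: mult.assoc del: quot.simps)
  then have "(-1) ^ Suc n * err (Suc n) * quot (Suc n) < 0"
    using Suc by simp
  then show ?case
    using quot_gt_1[of "Suc n"] by (auto simp: mult_less_0_iff simp del: quot.simps power_Suc)
qed (simp add: err_0)

section \<open>Periods\<close>

text \<open>Adding an integer does not change the fractional part, so \<open>quot (Suc k)\<close>
  and \<open>x\<close> have the same successor, and from there on the algorithm repeats
  itself.\<close>

lemma quot_shift:
  assumes "quot (Suc k) = x + of_int c" and "i \<ge> 1"
  shows "quot (i + Suc k) = quot i"
  using assms(2)
proof (induction i rule: dec_induct)
  case base
  have "int (b (Suc k)) = int (b 0) + c"
    using quot_floor[of "Suc k"] quot_floor[of 0] assms(1) by (simp del: quot.simps(2))
  then have "real (b (Suc k)) = real (b 0) + of_int c"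
    by (metis of_int_add of_int_of_nat_eq)
  then show ?case using assms(1) by (simp add: algebra_simps)
next
  case (step i)
  have "b (i + Suc k) = b i"
    using step quot_floor[of i] quot_floor[of "i + Suc k"] by (simp del: quot.simps)
  then show ?case using step by simp
qed

lemma period_shift:
  assumes "quot (Suc k) = x + of_int c" and "i \<ge> 1"
  shows "b (i + Suc k) = b i"
  using quot_shift[OF assms] quot_floor[of i] quot_floor[of "i + Suc k"]
  by (simp del: quot.simps)

text \<open>The terms from index \<open>k + 2\<close> on agree with those from index 1 on, and an
  expansion has only one limit; hence the two complete quotients agree. One step backwards, the last
  term \<open>2 * b 0\<close> of the block replaces \<open>b 0\<close>, which adds
  \<open>b 0\<close> to \<open>x\<close>.\<close>

lemma quot_of_period:
  assumes "has_periodic_cfrac k b x"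
  shows "quot (Suc k) = x + real (b 0)"
proof -
  have b: "b (Suc k) = 2 * b 0" "\<And>i. i \<ge> 1 \<Longrightarrow> b (i + Suc k) = b i"
    using assms by (auto simp: has_periodic_cfrac_def)
  have "(\<lambda>i. b (i + Suc (Suc k))) = (\<lambda>i. b (i + Suc 0))"
    using b(2)[of "Suc i" for i] by (auto simp: fun_eq_iff)
  then have "quot (Suc (Suc k)) = quot (Suc 0)"
    using cfrac_quot[of "Suc (Suc k)"] cfrac_quot[of "Suc 0"]
    by (metis LIMSEQ_unique has_cfrac_def)
  then show ?thesis
    using quot_eq[of "Suc k"] quot_eq[of 0] b(1) by (simp del: quot.simps(2))
qed

lemma period_iterate:
  assumes "has_periodic_cfrac m b x" and "i \<ge> 1"
  shows "b (i + j * (m + 1)) = b i"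
proof (induction j)
  case (Suc j)
  have "b (i + j * (m + 1) + (m + 1)) = b (i + j * (m + 1))"
    using assms by (auto simp: has_periodic_cfrac_def)
  then show ?case using Suc by (simp add: algebra_simps)
qed simp

lemma period_multiple:
  assumes "has_periodic_cfrac m b x" and "l \<ge> 1"
  shows "has_periodic_cfrac (l * (m + 1) - 1) b x"
proof -
  have m: "b (m + 1) = 2 * b 0"
    using assms(1) by (simp add: has_periodic_cfrac_def)
  note shift = period_iterate[OF assms(1)]
  have "b (l * (m + 1)) = b (m + 1)"
    using shift[of "m + 1" "l - 1"] assms(2) by (cases l) (auto simp: algebra_simps)
  moreover have "l * (m + 1) - 1 + 1 = l * (m + 1)"
    using assms(2) by simp
  ultimately show ?thesis
    using shift m expansion by (simp only: has_periodic_cfrac_def) auto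
qed

text \<open>Otherwise the nonzero remainder \<open>t\<close> of \<open>k + 1\<close> modulo
  \<open>m + 1\<close> would itself be a period, shorter than the minimal one.\<close>

lemma period_dvd:
  assumes m: "has_periodic_cfrac m b x"
    and least: "\<And>m'. has_periodic_cfrac m' b x \<Longrightarrow> m \<le> m'"
    and k: "quot (Suc k) = x + of_int c"
  shows "(m + 1) dvd (k + 1)"
proof (rule ccontr)
  assume ndvd: "\<not> (m + 1) dvd (k + 1)"
  define t where "t = (k + 1) mod (m + 1)"
  define l where "l = (k + 1) div (m + 1)"
  have kt: "k + 1 = t + l * (m + 1)" unfolding t_def l_def by (simp only: mod_div_mult_eq)
  have t: "t > 0" "t < m + 1"
    using ndvd by (auto simp: t_def dvd_eq_mod_eq_0)
  have b: "b (m + 1) = 2 * b 0" "\<And>i. i \<ge> 1 \<Longrightarrow> b (i + (m + 1)) = b i"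
    using m by (auto simp: has_periodic_cfrac_def)
  note shift = period_iterate[OF m]
  have "b (i + t) = b i" if "i \<ge> 1" for i
  proof -
    have "b (i + t) = b (i + t + l * (m + 1))"
      using shift[of "i + t" l] that by simp
    also have "\<dots> = b (i + (k + 1))"
      by (simp only: kt add.assoc)
    finally show ?thesis using period_shift[OF k that] by simp
  qed
  \<comment> \<open>Both shifts are applied to \<open>b (t + (m + 1))\<close>: removing
    \<open>m + 1\<close> leaves \<open>b t\<close>, removing \<open>t\<close> leaves
    \<open>b (m + 1)\<close>.\<close>
  moreover have "b t = 2 * b 0"
    using calculation[of "m + 1"] b(2)[of t] b(1) t by (simp add: add.commute)
  ultimately have "has_periodic_cfrac (t - 1) b x"
    using t expansion by (simp add: has_periodic_cfrac_def)
  then show False using least[of "t - 1"] t by linarith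
qed

section \<open>Periods and the norm equation\<close>

lemma norm_of_period:
  assumes "quot (Suc k) = x + real (b 0)" and "real Q * x\<^sup>2 = real D" and "coprime D Q"
  obtains y where "cfrac_den b (Suc k) = y * int Q"
    and "(cfrac_num b (Suc k))\<^sup>2 - int (D * Q) * y\<^sup>2 = (-1) ^ Suc k"
proof -
  define p q p' q' where "p = cfrac_num b (Suc k)" and "q = cfrac_den b (Suc k)"
    and "p' = cfrac_num b k" and "q' = cfrac_den b k"
  note defs = p_def q_def p'_def q'_def
  have "(of_int q * x - of_int p) * (x + real (b 0)) + (of_int q' * x - of_int p') = 0"
    using err_quot[of k] assms(1) by (simp add: err_def defs del: quot.simps cfrac_num.simps cfrac_den.simps)
  \<comment> \<open>The factor \<open>Q\<close> clears the denominator of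
    \<open>x\<^sup>2 = D / Q\<close>, so that all coefficients become integers.\<close>
  then have "real Q * ((of_int q * x - of_int p) * (x + real (b 0)) + (of_int q' * x - of_int p')) = 0"
    by simp
  then have "of_int q * (real Q * x\<^sup>2) + real Q * (of_int q * real (b 0) - of_int p + of_int q') * x
      - real Q * (of_int p * real (b 0) + of_int p') = 0"
    by (simp add: algebra_simps power2_eq_square)
  then have "of_int (int Q * (q * int (b 0) - p + q')) * x =
      of_int (int Q * (p * int (b 0) + p') - q * int D)"
    by (simp add: assms(2))
  note eqs = irrational_combination_eq_0[OF irrational this]
  have qD: "q * int D = int Q * (p * int (b 0) + p')" using eqs(2) by simp
  then have "int Q dvd q"
    using assms(3) by (metis coprime_commute coprime_dvd_mult_left_iff coprime_int_iff dvd_triv_left)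
  then obtain y where y: "q = y * int Q" by (metis dvd_def mult.commute)
  have "x \<noteq> 0" using irrational by auto
  then have Q: "Q \<noteq> 0" using assms by (cases "Q = 0") auto
  have 1: "p = q * int (b 0) + q'" using eqs(1) Q by simp
  have 2: "y * int D = p * int (b 0) + p'"
  proof -
    have "int Q * (y * int D) = int Q * (p * int (b 0) + p')"
      using qD by (simp add: y mult_ac)
    then show ?thesis using Q by simp
  qed
  \<comment> \<open>Substituting \<open>1\<close> for one factor \<open>p\<close> and
    \<open>2\<close> for \<open>y * D\<close> turns the norm into the determinant of two consecutive
    convergents.\<close>
  have "p\<^sup>2 - int (D * Q) * y\<^sup>2 = p * p - q * (y * int D)"
    by (simp add: y power2_eq_square)
  also have "\<dots> = p * (q * int (b 0) + q') - q * (p * int (b 0) + p')"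
    using 1 2 by simp
  also have "\<dots> = p * q' - p' * q"
    by (simp add: algebra_simps)
  also have "\<dots> = (-1) ^ Suc k"
    unfolding defs by (rule cfrac_det)
  finally show ?thesis using that[OF y[unfolded q_def]] unfolding p_def by blast
qed

text \<open>Multiplying \<open>err_quot\<close> by the conjugate \<open>q * x + p\<close> turns its
  left side into the norm times \<open>quot (Suc k)\<close>, up to sign. On the right the
  coefficient of \<open>x\<close> is a determinant equal to \<open>e\<close>, and the rest is an
  integer because \<open>q * x\<^sup>2\<close> is one.\<close>

lemma quot_of_norm:
  assumes t: "of_int (cfrac_den b (Suc k)) * x\<^sup>2 = of_int t"
    and e: "(cfrac_num b (Suc k))\<^sup>2 - cfrac_den b (Suc k) * t = e" "\<bar>e\<bar> = 1"
  obtains c :: int where "quot (Suc k) = x + of_int c"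
proof -
  define p q p' q' where "p = cfrac_num b (Suc k)" and "q = cfrac_den b (Suc k)"
    and "p' = cfrac_num b k" and "q' = cfrac_den b k"
  note defs = p_def q_def p'_def q'_def
  note [simp del] = quot.simps cfrac_num.simps cfrac_den.simps power_Suc
  have pq: "p > 0" "q > 0"
    using pos by (auto simp: defs intro!: cfrac_num_pos cfrac_den_pos)
  have x: "x > 0" using quot_gt_1[of 0] by (simp add: quot.simps)
  have den: "real_of_int q * x + real_of_int p > 0"
    using pq x by (simp add: add_pos_pos)
  have qt: "of_int q * x\<^sup>2 = of_int t" using t by (simp add: defs)
  have norm: "err (Suc k) * (of_int q * x + of_int p) = - of_int e"
  proof -
    have "err (Suc k) * (of_int q * x + of_int p) = of_int q * (of_int q * x\<^sup>2) - (of_int p)\<^sup>2"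
      by (simp add: err_def flip: defs) (simp add: algebra_simps power2_eq_square)
    also have "\<dots> = - of_int e" by (simp add: qt flip: e(1) defs)
    finally show ?thesis .
  qed
  \<comment> \<open>The conjugate is positive, so the sign of the norm is dictated by the
    alternating sign of the error.\<close>
  have e_eq: "e = (-1) ^ Suc k"
  proof -
    have "(-1) ^ Suc k * err (Suc k) * (of_int q * x + of_int p) < 0"
      using err_sign[of "Suc k"] den by (rule mult_neg_pos)
    then have "(-1) ^ Suc k * real_of_int e > 0"
      using norm by (simp add: mult.assoc)
    then show ?thesis using e(2) by (cases "even k") auto
  qed
  have "- of_int e * quot (Suc k) = - err k * (of_int q * x + of_int p)"
    using norm err_quot[of k] by (metis mult.commute mult.left_commute)
  also have "\<dots> = - (of_int q' * (of_int q * x\<^sup>2) + of_int (p * q' - p' * q) * x - of_int (p' * p))"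
    by (simp add: err_def flip: defs) (simp add: algebra_simps power2_eq_square)
  also have "p * q' - p' * q = e"
    unfolding e_eq defs by (rule cfrac_det)
  finally have "of_int e * quot (Suc k) = of_int e * x + of_int (q' * t - p' * p)"
    by (simp add: qt)
  then have "of_int e * (of_int e * quot (Suc k)) = of_int e * (of_int e * x + of_int (q' * t - p' * p))"
    by simp
  moreover have "real_of_int e * real_of_int e = 1"
    using e(2) by (auto simp: abs_if split: if_splits)
  ultimately have "quot (Suc k) = x + of_int (e * (q' * t - p' * p))"
    by (simp add: distrib_left flip: mult.assoc)
  then show ?thesis by (rule that)
qed

section \<open>Legendre's criterion\<close>

text \<open>The pair \<open>(p, s)\<close> is an integer combination of two consecutive convergents.
  The bounds on \<open>s\<close> force coefficients of opposite signs; the errors also have opposite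
  signs, so the two contributions add up instead of cancelling.\<close>

lemma best_approx:
  fixes p s :: int
  assumes s: "0 < s" "s < cfrac_den b (Suc (Suc n))"
    and ne: "p * cfrac_den b (Suc n) \<noteq> cfrac_num b (Suc n) * s"
  shows "\<bar>err (Suc n)\<bar> \<le> \<bar>of_int s * x - of_int p\<bar>"
proof -
  define P Q P' Q' where "P = cfrac_num b (Suc n)" and "Q = cfrac_den b (Suc n)"
    and "P' = cfrac_num b (Suc (Suc n))" and "Q' = cfrac_den b (Suc (Suc n))"
  note defs = P_def Q_def P'_def Q'_def
  note [simp del] = cfrac_num.simps cfrac_den.simps power_Suc
  define d :: int where "d = (-1) ^ n"
  have dd: "d * d = 1" by (simp add: d_def flip: power_add)
  have det: "P' * Q - P * Q' = d"
    using cfrac_det[of b "Suc n"] by (simp add: defs d_def power_Suc)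
  \<comment> \<open>Cramer's rule for \<open>p = a * P + c * P'\<close> and
    \<open>s = a * Q + c * Q'\<close>; the determinant \<open>d\<close> is its own inverse.\<close>
  define a c where "a = d * (s * P' - p * Q')" and "c = d * (p * Q - s * P)"
  have "a * P + c * P' = d * p * (P' * Q - P * Q')" "a * Q + c * Q' = d * s * (P' * Q - P * Q')"
    by (simp_all add: a_def c_def algebra_simps)
  then have p: "p = a * P + c * P'" and s_eq: "s = a * Q + c * Q'"
    using dd by (simp_all add: det algebra_simps)
  have c0: "c \<noteq> 0"
    using ne dd by (auto simp: c_def defs mult.commute)
  have Q: "Q > 0" "Q' > 0" using pos by (auto simp: defs intro!: cfrac_den_pos)
  have ac: "(a > 0 \<and> c < 0) \<or> (a < 0 \<and> c > 0)"
  proof (cases "c > 0")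
    case True
    then have "Q' \<le> c * Q'" using Q by (simp add: mult_le_cancel_right1)
    then have "a * Q < 0" using s(2) s_eq unfolding defs by linarith
    then show ?thesis using True Q by (simp add: mult_less_0_iff)
  next
    case False
    then have "c * Q' < 0" using c0 Q by (simp add: mult_less_0_iff)
    then have "a * Q > 0" using s s_eq by simp
    then show ?thesis using False c0 Q by (simp add: zero_less_mult_iff)
  qed
  have "err (Suc n) * err (Suc (Suc n)) < 0"
  proof -
    have "(-1) ^ Suc n * err (Suc n) * ((-1) ^ Suc (Suc n) * err (Suc (Suc n))) > 0"
      using err_sign by (intro mult_neg_neg)
    then show ?thesis by (cases "even n") (simp_all add: power_Suc)
  qed
  moreover have "real_of_int a * real_of_int c < 0"
    using ac by (auto simp: mult_less_0_iff)
  ultimately have "(of_int a * of_int c) * (err (Suc n) * err (Suc (Suc n))) > 0"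
    by (intro mult_neg_neg)
  then have same_sign: "(of_int a * err (Suc n)) * (of_int c * err (Suc (Suc n))) \<ge> 0"
    by (simp add: mult_ac)
  have "\<bar>err (Suc n)\<bar> \<le> \<bar>of_int a * err (Suc n)\<bar>"
    using ac by (auto simp: abs_mult mult_le_cancel_right1)
  also have "\<dots> \<le> \<bar>of_int a * err (Suc n) + of_int c * err (Suc (Suc n))\<bar>"
    using same_sign by (auto simp: zero_le_mult_iff)
  also have "of_int a * err (Suc n) + of_int c * err (Suc (Suc n)) = of_int s * x - of_int p"
    by (simp add: err_def p s_eq flip: defs) (simp add: algebra_simps)
  finally show ?thesis .
qed

lemma legendre:
  fixes p s :: int
  assumes s: "s > 0" and cop: "coprime p s"
    and approx: "2 * of_int s * \<bar>of_int s * x - of_int p\<bar> < 1"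
  obtains k where "p = cfrac_num b (Suc k)" "s = cfrac_den b (Suc k)"
proof -
  note [simp del] = cfrac_num.simps cfrac_den.simps
  \<comment> \<open>This choice places \<open>s\<close> between the denominators of the convergents
    with indices \<open>n\<close> and \<open>n + 1\<close>.\<close>
  define n where "n = (LEAST n. s < cfrac_den b (Suc (Suc n)))"
  have ex: "s < cfrac_den b (Suc (Suc (nat s)))"
    using cfrac_den_ge[of b "Suc (nat s)"] pos s by simp
  then have less: "s < cfrac_den b (Suc (Suc n))"
    unfolding n_def by (rule LeastI)
  have le: "cfrac_den b (Suc n) \<le> s"
  proof (cases n)
    case 0
    then show ?thesis using s by (simp add: cfrac_den.simps)
  next
    case (Suc j)
    then have "\<not> s < cfrac_den b (Suc (Suc j))"
      using not_less_Least[of j "\<lambda>n. s < cfrac_den b (Suc (Suc n))"] by (simp add: n_def)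
    then show ?thesis using Suc by simp
  qed
  define P Q where "P = cfrac_num b (Suc n)" and "Q = cfrac_den b (Suc n)"
  have Q: "Q > 0" using pos by (simp add: Q_def cfrac_den_pos)
  have eq: "p * Q = P * s"
  \<comment> \<open>Distinct fractions give a nonzero integer \<open>p * Q - P * s\<close>, yet its
    absolute value is at most \<open>(s + Q) * \<delta>\<close>, hence at most
    \<open>2 * s * \<delta>\<close>, which is below 1.\<close>
  proof (rule ccontr)
    assume ne: "p * Q \<noteq> P * s"
    define \<delta> where "\<delta> = \<bar>of_int s * x - of_int p\<bar>"
    have "\<bar>of_int Q * x - of_int P\<bar> \<le> \<delta>"
      using best_approx[OF s less] ne by (simp add: P_def Q_def err_def \<delta>_def)
    moreover have "real_of_int (p * Q - P * s) =
        of_int s * (of_int Q * x - of_int P) - of_int Q * (of_int s * x - of_int p)"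
      by (simp add: algebra_simps)
    ultimately have "\<bar>real_of_int (p * Q - P * s)\<bar> \<le> of_int s * \<delta> + of_int Q * \<delta>"
      using s Q
      by (auto simp: \<delta>_def abs_mult intro!: order_trans[OF abs_triangle_ineq4] add_mono mult_left_mono)
    also have "\<dots> \<le> of_int s * \<delta> + of_int s * \<delta>"
      using le by (intro add_left_mono mult_right_mono) (auto simp: Q_def \<delta>_def)
    also have "\<dots> < 1" using approx by (simp add: \<delta>_def)
    finally have "\<bar>p * Q - P * s\<bar> < 1" by linarith
    then show False using ne by simp
  qed
  have "coprime P Q" by (simp add: P_def Q_def coprime_cfrac_num_den)
  then show ?thesis
    using that[of n] coprime_fraction_eq[OF eq cop] s Q by (simp add: P_def Q_def)
qed

end

section \<open>Units\<close>

text \<open>Units have norm 1 or -1 by multiplicativity of the norm. If \<open>u > 1\<close>, its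
  conjugate \<open>v\<close> satisfies \<open>\<bar>v\<bar> < 1\<close>, so \<open>u + v\<close> and
  \<open>u - v\<close> are positive, which gives the signs of \<open>x\<close> and \<open>y\<close>.
  Conversely, the norm times the conjugate is an inverse.\<close>

lemma units_in_Z_sqrt_gt_1_iff:
  fixes n :: nat and u :: real
  assumes irr: "sqrt n \<notin> \<rat>"
  shows "u \<in> units_in (Z_sqrt n) \<and> u > 1 \<longleftrightarrow>
    (\<exists>x y :: int. x > 0 \<and> y > 0 \<and> \<bar>x\<^sup>2 - int n * y\<^sup>2\<bar> = 1 \<and> u = of_int x + of_int y * sqrt n)"
    (is "?L \<longleftrightarrow> ?R")
proof
  define w where "w = sqrt n"
  have ww: "w * w = real n" by (simp add: w_def)
  have w: "w > 0" using irr by (cases "n = 0") (auto simp: w_def)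
  {
    assume ?L
    then obtain x y x' y' :: int
      where u: "u = of_int x + of_int y * w" and prod: "u * (of_int x' + of_int y' * w) = 1"
        and u1: "u > 1"
      by (auto simp: units_in_def Z_sqrt_def w_def)
    have "of_int (x * y' + x' * y) * w = of_int (1 - x * x' - y * y' * int n)"
      using prod by (simp add: u algebra_simps flip: ww)
    note eqs = irrational_combination_eq_0[OF irr[folded w_def] this]
    have "(x\<^sup>2 - int n * y\<^sup>2) * (x'\<^sup>2 - int n * y'\<^sup>2) =
        (x * x' + y * y' * int n)\<^sup>2 - int n * (x * y' + x' * y)\<^sup>2"
      by (simp add: algebra_simps power2_eq_square)
    also have "x * x' + y * y' * int n = 1" using eqs(2) by simp
    also have "1\<^sup>2 - int n * (x * y' + x' * y)\<^sup>2 = 1" using eqs(1) by simp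
    finally have norm: "\<bar>x\<^sup>2 - int n * y\<^sup>2\<bar> = 1"
      by (metis abs_zmult_eq_1 abs_1)
    define v where "v = of_int x - of_int y * w"
    have "u * v = of_int (x\<^sup>2 - int n * y\<^sup>2)"
      by (simp add: u v_def algebra_simps power2_eq_square flip: ww)
    then have "\<bar>u * v\<bar> = 1" using norm by (metis of_int_abs of_int_1)
    then have "\<bar>v\<bar> < 1"
      using u1 mult_left_mono[of 1 "\<bar>v\<bar>" u] by (force simp: abs_mult)
    then have "real_of_int x > 0" "of_int y * w > 0"
      using u1 by (auto simp: u v_def)
    then have "x > 0" "y > 0"
      using w by (auto simp: zero_less_mult_iff)
    then show ?R using norm u by (auto simp: w_def)
  }
  {
    assume ?R
    then obtain x y :: int where xy: "x > 0" "y > 0" and norm: "\<bar>x\<^sup>2 - int n * y\<^sup>2\<bar> = 1"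
      and u: "u = of_int x + of_int y * w"
      by (auto simp: w_def)
    define e where "e = x\<^sup>2 - int n * y\<^sup>2"
    have ee: "real_of_int e * of_int e = 1"
      using norm by (auto simp: abs_if simp flip: e_def split: if_splits)
    have "u * (of_int (e * x) + of_int (- e * y) * w) = of_int e * of_int e"
      by (simp add: u e_def algebra_simps power2_eq_square flip: ww)
    then have "u * (of_int (e * x) + of_int (- e * y) * w) = 1" using ee by simp
    moreover have "of_int (e * x) + of_int (- e * y) * w \<in> Z_sqrt n" "u \<in> Z_sqrt n"
      unfolding Z_sqrt_def u w_def by blast+
    ultimately have "u \<in> units_in (Z_sqrt n)"
      unfolding units_in_def by blast
    moreover have "u > 1"
    proof -
      have "of_int y * w > 0" using xy w by simp
      moreover have "real_of_int x \<ge> 1" using xy by simp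
      ultimately show ?thesis by (simp add: u)
    qed
    ultimately show ?L by simp
  }
qed

theorem theorem2:
  fixes D Q q D2 m :: nat and D1 :: real and b r s :: "nat \<Rightarrow> nat"
  assumes "D > 0" and "Q > 0" and "coprime D Q"
    and "real D / real Q > 1"
    and "\<not> (\<exists>t::rat. of_nat D / of_nat Q = t ^ 2)"
    and "q = (LEAST d. d dvd Q \<and> Q dvd d ^ 2)"
    and "D1 = real D * real q ^ 2 / real Q"
    and "D2 = D * Q"
    and "has_periodic_cfrac m b (sqrt (real D / real Q))"
    and "m = (LEAST m'. \<exists>b'. has_periodic_cfrac m' b' (sqrt (real D / real Q)))"
    and "\<And>k. r k > 0 \<and> s k > 0 \<and> coprime (r k) (s k) \<and> real (r k) / real (s k) = cfrac_conv b k"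
  shows "D1 \<in> \<nat> - {0} \<and>
    {u \<in> units_in (Z_sqrt D2). u > 1} =
      {of_int x + of_int y * sqrt D1 | x y :: int.
         \<exists>l\<ge>1. \<exists>k. k = l * (m + 1) - 1 \<and> x = int (r k) \<and> y * int q = int (s k)} \<and>
    (\<forall>l\<ge>1. q dvd s (l * (m + 1) - 1))"
proof -
  define \<alpha> where "\<alpha> = sqrt (real D / real Q)"
  have \<alpha>2: "\<alpha>\<^sup>2 = real D / real Q" by (simp add: \<alpha>_def)
  have Q\<alpha>: "real Q * \<alpha>\<^sup>2 = real D" using \<open>Q > 0\<close> by (simp add: \<alpha>2)
  have \<alpha>1: "\<alpha> > 1" using assms(4) by (simp add: \<alpha>_def)
  have irr: "\<alpha> \<notin> \<rat>"
  proof
    assume "\<alpha> \<in> \<rat>"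
    then obtain t where "\<alpha> = of_rat t" by (auto simp: Rats_def)
    then have "of_rat (of_nat D / of_nat Q) = (of_rat (t\<^sup>2) :: real)"
      using \<alpha>2 by (simp add: of_rat_divide of_rat_power)
    then show False using assms(5) by (metis of_rat_eq_iff)
  qed
  have per: "has_periodic_cfrac m b \<alpha>" using assms(9) by (simp add: \<alpha>_def)
  interpret irrational_cfrac b \<alpha>
    using per irr by unfold_locales (auto simp: has_periodic_cfrac_def)
  note [simp del] = cfrac_num.simps cfrac_den.simps quot.simps power_Suc
  \<comment> \<open>The minimum defining \<open>m\<close> ranges over all sequences; here it is
    specialised to \<open>b\<close>.\<close>
  have least: "m \<le> m'" if "has_periodic_cfrac m' b \<alpha>" for m'
    using that unfolding assms(10) \<alpha>_def by (intro Least_le) auto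
  have rs: "int (r k) = cfrac_num b (Suc k)" "int (s k) = cfrac_den b (Suc k)" for k
  proof -
    have den: "cfrac_den b (Suc k) > 0" using pos by (simp add: cfrac_den_pos)
    have "real (r k) / real (s k) = cfrac_num b (Suc k) / cfrac_den b (Suc k)"
      using assms(11)[of k] pos by (simp add: cfrac_conv_eq)
    then have "real_of_int (int (r k) * cfrac_den b (Suc k)) =
        real_of_int (cfrac_num b (Suc k) * int (s k))"
      using assms(11)[of k] den by (simp add: divide_simps mult.commute)
    then have "int (r k) * cfrac_den b (Suc k) = cfrac_num b (Suc k) * int (s k)"
      by (simp only: of_int_eq_iff)
    moreover have "coprime (int (r k)) (int (s k))" "int (s k) > 0"
      using assms(11)[of k] by (simp_all add: coprime_int_iff)
    ultimately show
      "int (r k) = cfrac_num b (Suc k)" "int (s k) = cfrac_den b (Suc k)"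
      using den coprime_cfrac_num_den[of b "Suc k"] coprime_fraction_eq by blast+
  qed

  have q: "q dvd Q" "Q dvd q\<^sup>2"
    unfolding assms(6) using LeastI[of "\<lambda>d. d dvd Q \<and> Q dvd d ^ 2" Q] by auto
  have q0: "q > 0" using q(1) \<open>Q > 0\<close> by (rule dvd_pos_nat[rotated])
  have D1_nat: "D1 \<in> \<nat> - {0}"
  proof -
    obtain c where c: "q\<^sup>2 = Q * c" using q(2) by (elim dvdE)
    then have "real q ^ 2 = real Q * real c" by (metis of_nat_mult of_nat_power)
    then have "D1 = real (D * c)" using assms(7) \<open>Q > 0\<close> by simp
    moreover have "c > 0" using c q0 by (cases "c = 0") auto
    ultimately show ?thesis using \<open>D > 0\<close> by simp
  qed
  \<comment> \<open>Both square roots are integer multiples of \<alpha>. Hence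
    \<open>y * sqrt D1\<close> with \<open>y * q = s k\<close> and \<open>z * sqrt D2\<close> with
    \<open>z * Q = s k\<close> are the same number \<open>s k * \<alpha>\<close>.\<close>
  have sqrt_D1: "sqrt D1 = real q * \<alpha>"
    by (simp add: assms(7) \<alpha>_def real_sqrt_mult real_sqrt_divide)
  have sqrt_D2: "sqrt (real D2) = real Q * \<alpha>"
  proof -
    have "real D2 = (real Q * \<alpha>)\<^sup>2"
      using Q\<alpha> by (simp add: assms(8) power_mult_distrib power2_eq_square mult_ac)
    then show ?thesis using \<alpha>1 by simp
  qed
  have irr2: "sqrt (real D2) \<notin> \<rat>"
  proof
    assume "sqrt (real D2) \<in> \<rat>"
    then have "sqrt (real D2) / real Q \<in> \<rat>" by (intro Rats_divide) auto
    then show False using irr \<open>Q > 0\<close> by (simp add: sqrt_D2)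
  qed

  have period_norm: "\<exists>y. int (s k) = y * int Q \<and> \<bar>(int (r k))\<^sup>2 - int D2 * y\<^sup>2\<bar> = 1"
    if "k = l * (m + 1) - 1" "l \<ge> 1" for k l
  proof -
    have "quot (Suc k) = \<alpha> + real (b 0)"
      using quot_of_period[OF period_multiple[OF per that(2)]] that(1) by simp
    from norm_of_period[OF this Q\<alpha> assms(3)] show ?thesis
      by (metis rs assms(8) power_minus1_even power_abs abs_minus_cancel abs_1 power_one)
  qed
  have dvd: "int q dvd int (s k)" if "k = l * (m + 1) - 1" "l \<ge> 1" for k l
    using period_norm[OF that] q(1) by (metis dvd_mult int_dvd_int_iff)

  have norm_period: "\<exists>l\<ge>1. \<exists>k. k = l * (m + 1) - 1 \<and> p = int (r k) \<and> y * int Q = int (s k)"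
    if py: "p > 0" "y > 0" and norm: "\<bar>p\<^sup>2 - int D2 * y\<^sup>2\<bar> = 1" for p y :: int
  proof -
    \<comment> \<open>Since \<open>sqrt D2 = Q * \<alpha>\<close>, the unit is
      \<open>p + z * \<alpha>\<close>, and \<open>p / z\<close> is the candidate convergent.\<close>
    define z where "z = y * int Q"
    have z: "z > 0" using py \<open>Q > 0\<close> by (simp add: z_def)
    have t: "of_int z * \<alpha>\<^sup>2 = of_int (y * int D)"
      using Q\<alpha> by (simp add: z_def mult.assoc)
    have D2y: "int D2 * y\<^sup>2 = z * (y * int D)"
      by (simp add: z_def assms(8) power2_eq_square)
    have cop: "coprime p z"
    proof (rule coprimeI)
      fix c assume "c dvd p" "c dvd z"
      then have "c dvd p\<^sup>2 - int D2 * y\<^sup>2"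
        unfolding D2y by (simp add: power2_eq_square)
      then show "is_unit c" using norm by (metis dvd_abs_iff)
    qed
    have prod: "\<bar>of_int z * \<alpha> - of_int p\<bar> * (of_int z * \<alpha> + of_int p) = 1"
    proof -
      have "of_int z * \<alpha> + of_int p > 0" using z py \<alpha>1 by (simp add: add_pos_pos)
      then have "\<bar>of_int z * \<alpha> - of_int p\<bar> * (of_int z * \<alpha> + of_int p) =
          \<bar>(of_int z * \<alpha> - of_int p) * (of_int z * \<alpha> + of_int p)\<bar>"
        by (simp add: abs_mult)
      also have "(of_int z * \<alpha> - of_int p) * (of_int z * \<alpha> + of_int p) =
          of_int z * (of_int z * \<alpha>\<^sup>2) - (of_int p)\<^sup>2"
        by (simp add: algebra_simps power2_eq_square)
      also have "\<dots> = - of_int (p\<^sup>2 - int D2 * y\<^sup>2)"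
        unfolding t D2y by simp
      also have "\<bar>\<dots>\<bar> = 1" using norm by (metis abs_minus_cancel of_int_abs of_int_1)
      finally show ?thesis .
    qed
    \<comment> \<open>The integer \<open>D2 * y\<^sup>2\<close> equals
      \<open>z\<^sup>2 * \<alpha>\<^sup>2\<close>, so it exceeds \<open>z\<^sup>2\<close>, and
      \<open>p\<^sup>2\<close> differs from it by only 1. Thus the conjugate factor in
      \<open>prod\<close> exceeds \<open>2 * z\<close>, which is the bound Legendre's criterion
      requires.\<close>
    have "p \<ge> z"
    proof -
      have "of_int z * of_int z < of_int z * (of_int z * \<alpha>\<^sup>2)"
        using z \<alpha>1 by (simp add: one_less_power)
      then have "real_of_int (z * z) < of_int (int D2 * y\<^sup>2)"
        unfolding t D2y by simp
      then have "z * z < int D2 * y\<^sup>2" by (simp only: of_int_less_iff)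
      then have "z\<^sup>2 \<le> p\<^sup>2" using norm by (simp add: power2_eq_square)
      then show ?thesis using py by (simp add: power2_le_iff_abs_le)
    qed
    moreover have "real_of_int z * 1 < of_int z * \<alpha>"
      using z \<alpha>1 by (intro mult_strict_left_mono) auto
    ultimately have less: "2 * of_int z < of_int z * \<alpha> + of_int p"
      by simp
    have "\<bar>of_int z * \<alpha> - of_int p\<bar> > 0"
      using prod by (cases "of_int z * \<alpha> - of_int p = 0") auto
    then have "2 * of_int z * \<bar>of_int z * \<alpha> - of_int p\<bar> <
        (of_int z * \<alpha> + of_int p) * \<bar>of_int z * \<alpha> - of_int p\<bar>"
      by (rule mult_strict_right_mono[OF less])
    also have "\<dots> = 1" using prod by (simp only: mult.commute)
    finally have "2 * of_int z * \<bar>of_int z * \<alpha> - of_int p\<bar> < 1" .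
    from legendre[OF z cop this] obtain k
      where k: "p = cfrac_num b (Suc k)" "z = cfrac_den b (Suc k)" .
    obtain c where "quot (Suc k) = \<alpha> + of_int c"
      using quot_of_norm[of k "y * int D" "p\<^sup>2 - int D2 * y\<^sup>2"] t norm D2y k by auto
    then have "(m + 1) dvd (k + 1)"
      using period_dvd[OF per least] by blast
    then obtain l where l: "k + 1 = l * (m + 1)" by (metis dvd_def mult.commute)
    then have "l \<ge> 1" by (cases l) auto
    moreover have "k = l * (m + 1) - 1" using l by simp
    ultimately show ?thesis using k rs z_def by auto
  qed

  have "u \<in> {u \<in> units_in (Z_sqrt D2). u > 1} \<longleftrightarrow>
      u \<in> {of_int x + of_int y * sqrt D1 | x y :: int.
         \<exists>l\<ge>1. \<exists>k. k = l * (m + 1) - 1 \<and> x = int (r k) \<and> y * int q = int (s k)}" for u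
  proof
    assume "u \<in> {u \<in> units_in (Z_sqrt D2). u > 1}"
    then obtain p y :: int where py: "p > 0" "y > 0" "\<bar>p\<^sup>2 - int D2 * y\<^sup>2\<bar> = 1"
      and u: "u = of_int p + of_int y * sqrt D2"
      using units_in_Z_sqrt_gt_1_iff[OF irr2] by auto
    \<comment> \<open>The cofactor \<open>c\<close> converts coefficients:
      \<open>sqrt D2 = c * sqrt D1\<close>.\<close>
    obtain c where c: "Q = q * c" using q(1) by (elim dvdE)
    have "u = of_int p + of_int (y * int c) * sqrt D1"
      using u by (simp add: sqrt_D1 sqrt_D2 c)
    moreover have "y * int c * int q = y * int Q" by (simp add: c)
    ultimately show "u \<in> {of_int x + of_int y * sqrt D1 | x y :: int.
         \<exists>l\<ge>1. \<exists>k. k = l * (m + 1) - 1 \<and> x = int (r k) \<and> y * int q = int (s k)}"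
      using norm_period[OF py] unfolding mem_Collect_eq by metis
  next
    assume "u \<in> {of_int x + of_int y * sqrt D1 | x y :: int.
         \<exists>l\<ge>1. \<exists>k. k = l * (m + 1) - 1 \<and> x = int (r k) \<and> y * int q = int (s k)}"
    then obtain y :: int and l k where k: "k = l * (m + 1) - 1" "l \<ge> 1"
      and y: "y * int q = int (s k)" and u: "u = of_int (int (r k)) + of_int y * sqrt D1"
      by blast
    obtain z where z: "int (s k) = z * int Q" "\<bar>(int (r k))\<^sup>2 - int D2 * z\<^sup>2\<bar> = 1"
      using period_norm[OF k] by blast
    have pos_r: "int (r k) > 0" and pos_s: "int (s k) > 0" using assms(11)[of k] by auto
    have "z > 0" using z(1) pos_s by (simp add: zero_less_mult_iff)
    have "real_of_int y * real q = of_int z * real Q"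
      using y z(1) by (metis of_int_mult of_int_of_nat_eq)
    then have "u = of_int (int (r k)) + of_int z * sqrt D2"
      by (simp add: u sqrt_D1 sqrt_D2 flip: mult.assoc)
    then show "u \<in> {u \<in> units_in (Z_sqrt D2). u > 1}"
      using units_in_Z_sqrt_gt_1_iff[OF irr2, of u] pos_r \<open>z > 0\<close> z(2) by blast
  qed
  then have "{u \<in> units_in (Z_sqrt D2). u > 1} =
      {of_int x + of_int y * sqrt D1 | x y :: int.
         \<exists>l\<ge>1. \<exists>k. k = l * (m + 1) - 1 \<and> x = int (r k) \<and> y * int q = int (s k)}"
    by (rule set_eqI)
  moreover have "\<forall>l\<ge>1. q dvd s (l * (m + 1) - 1)"
    using dvd[OF refl] by (simp add: int_dvd_int_iff)
  ultimately show ?thesis using D1_nat by blast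
qed

end
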